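(* Let $R$ be a commutative ring with unity. The following conditions are equivalent: (1) For each $R$-algebra $S$ and for each indecomposable left $S$-module $M$, there is only one minimal prime ideal $A$ of $R$ such that $\mathrm{Supp}\,M\subseteq V(A)$ (i.e. exactly one such $A$ exists). (2) Each prime ideal of $R$ contains a unique minimal prime ideal and $\mathrm{QMin}\,R$ is totally disconnected.
   Context: $V(A)=\{P\in\mathrm{Spec}\,R\mid A\subseteq P\}$. $R$-algebras are associative and unital but not necessarily commutative. For a left $S$-module $M$, viewed as an $R$-module, $\mathrm{Supp}\,M=\{P\in\mathrm{Spec}\,R\mid M_P\neq 0\}$. Indecomposable modules are nonzero. When each prime ideal of $R$ contains only one minimal prime ideal, let $\lambda$ be the surjective map from $\mathrm{Spec}\,R$ to the set of minimal prime ideals sending $P$ to the only minimal prime ideal contained in $P$; $\mathrm{QMin}\,R$ denotes the set of minimal prime ideals endowed with the quotient topology induced via $\lambda$ by the Zariski topology of $\mathrm{Spec}\,R$. *)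

theory Defs
  imports "HOL-Analysis.Abstract_Topology" "HOL-Algebra.Ideal" "HOL-Algebra.Module"
begin

section \<open>Prime spectrum and minimal primes\<close>

definition Spec :: "('a, 'r) ring_scheme \<Rightarrow> 'a set set"
  where "Spec R = {P. primeideal P R}"

definition Vset :: "('a, 'r) ring_scheme \<Rightarrow> 'a set \<Rightarrow> 'a set set"
  where "Vset R A = {P \<in> Spec R. A \<subseteq> P}"

definition MinSpec :: "('a, 'r) ring_scheme \<Rightarrow> 'a set set"
  where "MinSpec R = {A \<in> Spec R. \<forall>Q \<in> Spec R. Q \<subseteq> A \<longrightarrow> Q = A}"

definition zariski :: "('a, 'r) ring_scheme \<Rightarrow> 'a set topology"
  where "zariski R = topology (\<lambda>U. \<exists>A \<subseteq> carrier R. U = Spec R - Vset R A)"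

lemma openin_zariski:
  assumes "cring R"
  shows "openin (zariski R) U \<longleftrightarrow> (\<exists>A \<subseteq> carrier R. U = Spec R - Vset R A)"
proof -
  let ?O = "\<lambda>U. \<exists>A \<subseteq> carrier R. U = Spec R - Vset R A"
  interpret R: cring R by fact
  have "?O (U \<inter> W)" if "?O U" "?O W" for U W
  proof -
    from that obtain A B where A: "A \<subseteq> carrier R" "U = Spec R - Vset R A"
      and B: "B \<subseteq> carrier R" "W = Spec R - Vset R B" by blast
    let ?C = "{a \<otimes>\<^bsub>R\<^esub> b | a b. a \<in> A \<and> b \<in> B}"
    have "?C \<subseteq> P \<longleftrightarrow> A \<subseteq> P \<or> B \<subseteq> P" if P: "P \<in> Spec R" for P
    proof -
      interpret P: primeideal P R using P by (simp add: Spec_def)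
      show ?thesis
      proof
        assume C: "?C \<subseteq> P"
        show "A \<subseteq> P \<or> B \<subseteq> P"
        proof (rule ccontr)
          assume "\<not> ?thesis"
          then obtain a b where ab: "a \<in> A" "a \<notin> P" "b \<in> B" "b \<notin> P" by blast
          then have "a \<otimes>\<^bsub>R\<^esub> b \<in> P" using C by auto
          then show False using P.I_prime[of a b] ab A(1) B(1) by auto
        qed
      next
        assume "A \<subseteq> P \<or> B \<subseteq> P"
        then show "?C \<subseteq> P"
        proof
          assume "A \<subseteq> P"
          then have "a \<otimes>\<^bsub>R\<^esub> b \<in> P" if "a \<in> A" "b \<in> B" for a b
            using that P.I_r_closed[of a b] B(1) by (meson subsetD)
          then show ?thesis by auto
        next
          assume "B \<subseteq> P"
          then have "a \<otimes>\<^bsub>R\<^esub> b \<in> P" if "a \<in> A" "b \<in> B" for a b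
            using that P.I_l_closed[of b a] A(1) by (meson subsetD)
          then show ?thesis by auto
        qed
      qed
    qed
    then have "Vset R ?C = Vset R A \<union> Vset R B"
      unfolding Vset_def by (simp add: Collect_disj_eq[symmetric] cong: conj_cong) blast
    then have "U \<inter> W = Spec R - Vset R ?C"
      unfolding A(2) B(2) by blast
    moreover have "?C \<subseteq> carrier R" using A(1) B(1) by auto
    ultimately show ?thesis by (intro exI[of _ ?C]) simp
  qed
  moreover have "?O (\<Union>K)" if K: "\<forall>U\<in>K. ?O U" for K
  proof -
    from K obtain f where f: "\<forall>U\<in>K. f U \<subseteq> carrier R \<and> U = Spec R - Vset R (f U)"
      by metis
    have "\<Union>K = (\<Union>U\<in>K. Spec R - Vset R (f U))" using f by simp
    also have "\<dots> = Spec R - Vset R (\<Union>(f ` K))" unfolding Vset_def by auto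
    finally have "\<Union>K = Spec R - Vset R (\<Union>(f ` K))" .
    moreover have "\<Union>(f ` K) \<subseteq> carrier R" using f by auto
    ultimately show ?thesis by (intro exI[of _ "\<Union>(f ` K)"]) simp
  qed
  ultimately have "istopology ?O" unfolding istopology_def by simp
  then show ?thesis by (simp add: zariski_def topology_inverse')
qed

lemma topspace_zariski:
  assumes "cring R"
  shows "topspace (zariski R) = Spec R"
proof -
  have "\<not> carrier R \<subseteq> P" if "primeideal P R" for P
  proof -
    interpret P: primeideal P R by fact
    show ?thesis using P.I_notcarr P.a_subset by blast
  qed
  then have "Vset R (carrier R) = {}"
    by (auto simp: Vset_def Spec_def)
  then have "openin (zariski R) (Spec R)"
    using openin_zariski[OF assms] by (metis Diff_empty subset_refl)
  moreover have "topspace (zariski R) \<subseteq> Spec R"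
    using openin_zariski[OF assms, of "topspace (zariski R)"] openin_topspace[of "zariski R"] by blast
  ultimately show ?thesis using openin_subset by blast
qed

definition quotient_topology :: "'x topology \<Rightarrow> ('x \<Rightarrow> 'y) \<Rightarrow> 'y set \<Rightarrow> 'y topology"
  where "quotient_topology X f Y =
    topology (\<lambda>U. U \<subseteq> Y \<and> openin X {x \<in> topspace X. f x \<in> U})"

lemma openin_quotient_topology:
  "openin (quotient_topology X f Y) U \<longleftrightarrow> U \<subseteq> Y \<and> openin X {x \<in> topspace X. f x \<in> U}"
proof -
  have "{x \<in> topspace X. f x \<in> U \<inter> W} =
      {x \<in> topspace X. f x \<in> U} \<inter> {x \<in> topspace X. f x \<in> W}"
    "{x \<in> topspace X. f x \<in> \<Union>K} = (\<Union>U\<in>K. {x \<in> topspace X. f x \<in> U})" for U W K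
    by auto
  then have "istopology (\<lambda>U. U \<subseteq> Y \<and> openin X {x \<in> topspace X. f x \<in> U})"
    unfolding istopology_def by (auto intro!: openin_Int openin_Union)
  then show ?thesis by (simp add: quotient_topology_def topology_inverse')
qed

definition totally_disconnected :: "'x topology \<Rightarrow> bool"
  where "totally_disconnected X \<longleftrightarrow> (\<forall>C. connectedin X C \<longrightarrow> (\<exists>x. C \<subseteq> {x}))"

definition primes_contain_unique_minimal :: "('a, 'r) ring_scheme \<Rightarrow> bool"
  where "primes_contain_unique_minimal R \<longleftrightarrow>
    (\<forall>P \<in> Spec R. \<exists>!A. A \<in> MinSpec R \<and> A \<subseteq> P)"

text \<open>The map \<open>\<lambda>\<close> from primes to minimal primes; it is meaningful only
  under \<^const>\<open>primes_contain_unique_minimal\<close>, and so is \<open>QMin\<close>.\<close>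

definition minimal_below :: "('a, 'r) ring_scheme \<Rightarrow> 'a set \<Rightarrow> 'a set"
  where "minimal_below R P = (THE A. A \<in> MinSpec R \<and> A \<subseteq> P)"

definition QMin :: "('a, 'r) ring_scheme \<Rightarrow> 'a set topology"
  where "QMin R = quotient_topology (zariski R) (minimal_below R) (MinSpec R)"


section \<open>Algebras and left modules over possibly noncommutative rings\<close>

text \<open>The library locale \<^locale>\<open>algebra\<close> makes the algebra commutative, and
  \<^locale>\<open>Module.module\<close> the ring of scalars; the next two locales drop this. In the
  noncommutative case the last axiom of \<open>assoc_algebra\<close>, which says that scalars are central,
  is not a consequence of the preceding one.\<close>

locale assoc_algebra = Module.module R S + ring S
  for R :: "('a, 'r) ring_scheme" (structure) and S :: "('a, 's, 't) module_scheme" (structure) +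
  assumes smult_mult_left:
      "\<lbrakk>a \<in> carrier R; x \<in> carrier S; y \<in> carrier S\<rbrakk> \<Longrightarrow>
        (a \<odot>\<^bsub>S\<^esub> x) \<otimes>\<^bsub>S\<^esub> y = a \<odot>\<^bsub>S\<^esub> (x \<otimes>\<^bsub>S\<^esub> y)"
    and smult_mult_right:
      "\<lbrakk>a \<in> carrier R; x \<in> carrier S; y \<in> carrier S\<rbrakk> \<Longrightarrow>
        x \<otimes>\<^bsub>S\<^esub> (a \<odot>\<^bsub>S\<^esub> y) = a \<odot>\<^bsub>S\<^esub> (x \<otimes>\<^bsub>S\<^esub> y)"

locale left_module = S?: ring S + M?: abelian_group M
  for S :: "('s, 't) ring_scheme" (structure) and M :: "('s, 'm, 'n) module_scheme" (structure) +
  assumes smult_closed: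
      "\<lbrakk>a \<in> carrier S; x \<in> carrier M\<rbrakk> \<Longrightarrow> a \<odot>\<^bsub>M\<^esub> x \<in> carrier M"
    and smult_l_distr:
      "\<lbrakk>a \<in> carrier S; b \<in> carrier S; x \<in> carrier M\<rbrakk> \<Longrightarrow>
        (a \<oplus>\<^bsub>S\<^esub> b) \<odot>\<^bsub>M\<^esub> x = a \<odot>\<^bsub>M\<^esub> x \<oplus>\<^bsub>M\<^esub> b \<odot>\<^bsub>M\<^esub> x"
    and smult_r_distr:
      "\<lbrakk>a \<in> carrier S; x \<in> carrier M; y \<in> carrier M\<rbrakk> \<Longrightarrow>
        a \<odot>\<^bsub>M\<^esub> (x \<oplus>\<^bsub>M\<^esub> y) = a \<odot>\<^bsub>M\<^esub> x \<oplus>\<^bsub>M\<^esub> a \<odot>\<^bsub>M\<^esub> y"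
    and smult_assoc:
      "\<lbrakk>a \<in> carrier S; b \<in> carrier S; x \<in> carrier M\<rbrakk> \<Longrightarrow>
        (a \<otimes>\<^bsub>S\<^esub> b) \<odot>\<^bsub>M\<^esub> x = a \<odot>\<^bsub>M\<^esub> (b \<odot>\<^bsub>M\<^esub> x)"
    and smult_one:
      "x \<in> carrier M \<Longrightarrow> \<one>\<^bsub>S\<^esub> \<odot>\<^bsub>M\<^esub> x = x"

definition indecomposable :: "('s, 't) ring_scheme \<Rightarrow> ('s, 'm, 'n) module_scheme \<Rightarrow> bool"
  where "indecomposable S M \<longleftrightarrow>
    carrier M \<noteq> {\<zero>\<^bsub>M\<^esub>} \<and>
    (\<forall>N N'. submodule N S M \<and> submodule N' S M \<and>
        N \<inter> N' = {\<zero>\<^bsub>M\<^esub>} \<and> N <+>\<^bsub>M\<^esub> N' = carrier M \<longrightarrow>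
      N = {\<zero>\<^bsub>M\<^esub>} \<or> N' = {\<zero>\<^bsub>M\<^esub>})"

definition restrict_scalars ::
    "('a, 's, 't) module_scheme \<Rightarrow> ('s, 'm, 'n) module_scheme \<Rightarrow> ('a, 'm) module"
  where "restrict_scalars S M =
    \<lparr>carrier = carrier M, mult = mult M, one = one M, zero = zero M, add = add M,
     smult = (\<lambda>r m. (r \<odot>\<^bsub>S\<^esub> \<one>\<^bsub>S\<^esub>) \<odot>\<^bsub>M\<^esub> m)\<rparr>"


section \<open>Localization and support\<close>

definition fraction_rel ::
    "'a set \<Rightarrow> ('a, 'm, 'n) module_scheme \<Rightarrow> (('m \<times> 'a) \<times> ('m \<times> 'a)) set"
  where "fraction_rel T M =
    {((m, s), (n, t)). m \<in> carrier M \<and> n \<in> carrier M \<and> s \<in> T \<and> t \<in> T \<and>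
       (\<exists>u \<in> T. u \<odot>\<^bsub>M\<^esub> (t \<odot>\<^bsub>M\<^esub> m) = u \<odot>\<^bsub>M\<^esub> (s \<odot>\<^bsub>M\<^esub> n))}"

definition fraction ::
    "'a set \<Rightarrow> ('a, 'm, 'n) module_scheme \<Rightarrow> 'm \<Rightarrow> 'a \<Rightarrow> ('m \<times> 'a) set"
  where "fraction T M m s = fraction_rel T M `` {(m, s)}"

text \<open>The localization of \<open>M\<close> at a multiplicative set \<open>T\<close>, as a module over \<open>R\<close>. The
  fields \<open>mult\<close> and \<open>one\<close> play no role in a module.\<close>

definition localization ::
    "('a, 'r) ring_scheme \<Rightarrow> 'a set \<Rightarrow> ('a, 'm, 'n) module_scheme \<Rightarrow> ('a, ('m \<times> 'a) set) module"
  where "localization R T M =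
    \<lparr>carrier = (carrier M \<times> T) // fraction_rel T M,
     mult = undefined, one = undefined,
     zero = fraction T M \<zero>\<^bsub>M\<^esub> \<one>\<^bsub>R\<^esub>,
     add = (\<lambda>X Y. \<Union>(m, s) \<in> X. \<Union>(n, t) \<in> Y.
       fraction T M (t \<odot>\<^bsub>M\<^esub> m \<oplus>\<^bsub>M\<^esub> s \<odot>\<^bsub>M\<^esub> n) (s \<otimes>\<^bsub>R\<^esub> t)),
     smult = (\<lambda>r X. \<Union>(m, s) \<in> X. fraction T M (r \<odot>\<^bsub>M\<^esub> m) s)\<rparr>"

definition Supp :: "('a, 'r) ring_scheme \<Rightarrow> ('a, 'm, 'n) module_scheme \<Rightarrow> 'a set set"
  where "Supp R M =
    {P \<in> Spec R. carrier (localization R (carrier R - P) M) \<noteq>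
      {\<zero>\<^bsub>localization R (carrier R - P) M\<^esub>}}"


section \<open>Condition on supports of indecomposable modules\<close>

text \<open>HOL cannot quantify over types inside a formula, so the types \<open>'s\<close> and \<open>'m\<close> that carry
  the algebras and the modules are parameters.\<close>

definition indecomposable_support_condition ::
    "('a, 'r) ring_scheme \<Rightarrow> 's itself \<Rightarrow> 'm itself \<Rightarrow> bool"
  where "indecomposable_support_condition R TYPE('s) TYPE('m) \<longleftrightarrow>
    (\<forall>(S :: ('a, 's) module) (M :: ('s, 'm) module).
      assoc_algebra R S \<and> left_module S M \<and> indecomposable S M \<longrightarrow>
      (\<exists>!A. A \<in> MinSpec R \<and> Supp R (restrict_scalars S M) \<subseteq> Vset R A))"

end

theory Submission
  imports Defs "HOL-Algebra.QuotRing"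
begin

text \<open>
  For a prime \<open>P\<close> let \<open>I\<close> be the ideal generated by the idempotents in \<open>P\<close>. Idempotents
  modulo \<open>I\<close> lift to \<open>R\<close>, so \<open>R/I\<close> has only the idempotents \<open>0\<close> and \<open>1\<close>. Consequently
  \<open>V(I)\<close> is connected, and \<open>R/I\<close> is an indecomposable \<open>R\<close>-module with support \<open>V(I)\<close>.

  If \<open>QMin R\<close> is totally disconnected, the image of \<open>V(I)\<close> in it is a single point, so two
  primes over different minimal primes are separated by an idempotent. Idempotents of \<open>R\<close> act as
  \<open>0\<close> or \<open>1\<close> on an indecomposable module, hence its support lies over one minimal prime.

  Conversely, \<open>M = R/P\<close> shows that \<open>P\<close> contains just one minimal prime. For a minimal prime
  \<open>P\<close>, \<open>M = R/I\<close> shows that \<open>P\<close> is the only minimal prime in \<open>V(I)\<close>, so every other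
  minimal prime is separated from \<open>P\<close> by an idempotent, that is, by a clopen subset of \<open>QMin R\<close>.
\<close>

section \<open>Prime ideals\<close>

context cring
begin

text \<open>Supplies the upper bounds for Zorn's lemma. Comparability gives closure under addition:
  two summands lie in a common member of \<open>C\<close>.\<close>

lemma ideal_Union_chain:
  assumes "C \<noteq> {}" "\<And>J. J \<in> C \<Longrightarrow> ideal J R"
    and chain: "\<And>J K. J \<in> C \<Longrightarrow> K \<in> C \<Longrightarrow> J \<subseteq> K \<or> K \<subseteq> J"
  shows "ideal (\<Union>C) R"
proof (rule idealI[OF ring_axioms])
  have sub: "additive_subgroup J R" if "J \<in> C" for J
    using assms(2)[OF that] by (rule ideal.axioms)
  show "subgroup (\<Union>C) (add_monoid R)"
  proof (rule group.subgroupI[OF a_group])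
    show "\<Union>C \<subseteq> carrier (add_monoid R)"
      using additive_subgroup.a_subset[OF sub] by auto
    show "\<Union>C \<noteq> {}"
      using additive_subgroup.zero_closed[OF sub] assms(1) by auto
    show "inv\<^bsub>add_monoid R\<^esub> a \<in> \<Union>C" if "a \<in> \<Union>C" for a
      using additive_subgroup.a_inv_closed[OF sub] that
      by (auto simp: a_inv_def)
    show "a \<otimes>\<^bsub>add_monoid R\<^esub> b \<in> \<Union>C" if ab: "a \<in> \<Union>C" "b \<in> \<Union>C" for a b
    proof -
      obtain J K where "J \<in> C" "a \<in> J" "K \<in> C" "b \<in> K" using ab by blast
      then obtain L where "L \<in> C" "a \<in> L" "b \<in> L" using chain[of J K] by blast
      then show ?thesis using additive_subgroup.a_closed[OF sub] by auto
    qed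
  qed
next
  fix a x assume "a \<in> \<Union>C" "x \<in> carrier R"
  then show "x \<otimes> a \<in> \<Union>C" "a \<otimes> x \<in> \<Union>C"
    using ideal.I_l_closed[OF assms(2)] ideal.I_r_closed[OF assms(2)] by blast+
qed

lemma mem_add_cgenideal:
  assumes "ideal J R" "x \<in> carrier R" "y \<in> J <+>\<^bsub>R\<^esub> PIdl x"
  obtains j r where "j \<in> J" "r \<in> carrier R" "y = j \<oplus> r \<otimes> x"
  using assms unfolding set_add_def' cgenideal_def by blast

lemma ideal_subset_add:
  assumes "ideal J R" "ideal K R"
  shows "J \<subseteq> J <+>\<^bsub>R\<^esub> K" "K \<subseteq> J <+>\<^bsub>R\<^esub> K"
proof -
  interpret J: ideal J R by fact
  interpret K: ideal K R by fact
  have "x \<oplus> \<zero> \<in> J <+>\<^bsub>R\<^esub> K" if "x \<in> J" for x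
    using that K.zero_closed unfolding set_add_def' by blast
  then show "J \<subseteq> J <+>\<^bsub>R\<^esub> K" by auto
  have "\<zero> \<oplus> x \<in> J <+>\<^bsub>R\<^esub> K" if "x \<in> K" for x
    using that J.zero_closed unfolding set_add_def' by blast
  then show "K \<subseteq> J <+>\<^bsub>R\<^esub> K" by auto
qed

text \<open>An ideal \<open>P\<close> maximal among those that contain \<open>I\<close> and no power
  of \<open>a\<close> is prime: for \<open>x\<close>, \<open>y\<close> outside \<open>P\<close>,
  both \<open>P + (x)\<close> and \<open>P + (y)\<close> contain powers of \<open>a\<close>, and the
  product of these powers would lie in \<open>P\<close> if \<open>x \<otimes> y\<close> did.\<close>

lemma exists_prime_avoiding_powers:
  assumes I: "ideal I R" and a: "a \<in> carrier R" and pow: "\<And>n::nat. a [^] n \<notin> I"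
  obtains P where "primeideal P R" "I \<subseteq> P" "a \<notin> P"
proof -
  let ?F = "{J. ideal J R \<and> I \<subseteq> J \<and> (\<forall>n::nat. a [^] n \<notin> J)}"
  have "\<exists>M\<in>?F. \<forall>X\<in>?F. M \<subseteq> X \<longrightarrow> X = M"
  proof (rule subset_Zorn_nonempty)
    show "?F \<noteq> {}" using I pow by blast
    fix C assume C: "C \<noteq> {}" "subset.chain ?F C"
    then have "ideal (\<Union>C) R"
      by (intro ideal_Union_chain) (auto simp: subset.chain_def)
    with C show "\<Union>C \<in> ?F" by (fastforce simp: subset.chain_def)
  qed
  then obtain P where P: "ideal P R" "I \<subseteq> P" and nP: "\<And>n::nat. a [^] n \<notin> P"
    and max: "\<And>X. ideal X R \<Longrightarrow> P \<subseteq> X \<Longrightarrow> (\<And>n::nat. a [^] n \<notin> X) \<Longrightarrow> X = P"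
    by (smt (verit) mem_Collect_eq order_trans)
  interpret P: ideal P R by fact
  have ext: "\<exists>n::nat. \<exists>p\<in>P. \<exists>r\<in>carrier R. a [^] n = p \<oplus> r \<otimes> x"
    if x: "x \<in> carrier R" "x \<notin> P" for x
  proof -
    note sub = ideal_subset_add[OF P(1) cgenideal_ideal[OF x(1)]]
    have id: "ideal (P <+>\<^bsub>R\<^esub> PIdl x) R"
      using add_ideals[OF P(1) cgenideal_ideal[OF x(1)]] .
    have "x \<in> P <+>\<^bsub>R\<^esub> PIdl x"
      using sub(2) cgenideal_self[OF x(1)] by blast
    then obtain n :: nat where "a [^] n \<in> P <+>\<^bsub>R\<^esub> PIdl x"
      using max[OF id sub(1)] x(2) by blast
    then show ?thesis
      using mem_add_cgenideal[OF P(1) x(1)] by metis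
  qed
  have "primeideal P R"
  proof (rule primeidealI[OF P(1) is_cring])
    \<comment> \<open>The exponent 0 is among the avoided powers, so \<one> is not in
      \<open>P\<close>.\<close>
    show "carrier R \<noteq> P" using nP[of 0] by auto
    fix x y assume xy: "x \<in> carrier R" "y \<in> carrier R" "x \<otimes> y \<in> P"
    show "x \<in> P \<or> y \<in> P"
    proof (rule ccontr)
      assume "\<not> ?thesis"
      then obtain n m :: nat and p q r s where
        n: "p \<in> P" "r \<in> carrier R" "a [^] n = p \<oplus> r \<otimes> x" and
        m: "q \<in> P" "s \<in> carrier R" "a [^] m = q \<oplus> s \<otimes> y"
        using ext[of x] ext[of y] xy by blast
      have c: "p \<in> carrier R" "q \<in> carrier R" using n m P.a_subset by auto
      have "a [^] (n + m) = (p \<oplus> r \<otimes> x) \<otimes> (q \<oplus> s \<otimes> y)"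
        using n m a by (simp add: nat_pow_mult[symmetric])
      also have "\<dots> = p \<otimes> (q \<oplus> s \<otimes> y) \<oplus> ((r \<otimes> x) \<otimes> q \<oplus> (r \<otimes> s) \<otimes> (x \<otimes> y))"
        using c n(2) m(2) xy by algebra
      also have "\<dots> \<in> P"
        using c n m xy by (intro P.a_closed P.I_l_closed[of "x \<otimes> y"] P.I_r_closed[of p] P.I_l_closed[of q]) auto
      finally show False using nP by blast
    qed
  qed
  then show thesis using that P(2) nP[of 1] a by auto
qed

lemma exists_prime_containing:
  assumes "ideal I R" "\<one> \<notin> I"
  obtains P where "primeideal P R" "I \<subseteq> P"
  using exists_prime_avoiding_powers[OF assms(1), of \<one>] assms(2) by (metis nat_pow_one one_closed)

end

lemma (in primeideal) pow_mem_imp_mem: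
  assumes "a \<in> carrier R" "a [^] (n::nat) \<in> I"
  shows "a \<in> I"
  using assms(2)
proof (induction n)
  case 0
  then show ?case using I_notcarr one_imp_carrier by simp
next
  case (Suc n)
  then show ?case using I_prime[of "a [^] n" a] assms(1) by auto
qed

lemma (in primeideal) one_notin: "\<one> \<notin> I"
  using I_notcarr one_imp_carrier by auto

lemma (in primeideal) one_minus_notin:
  assumes "a \<in> I"
  shows "\<one> \<ominus> a \<notin> I"
proof
  assume "\<one> \<ominus> a \<in> I"
  then have "(\<one> \<ominus> a) \<oplus> a \<in> I" using assms by auto
  moreover have "(\<one> \<ominus> a) \<oplus> a = \<one>" using assms a_Hcarr by algebra
  ultimately show False using one_notin by simp
qed

section \<open>Ideals with connected zero set\<close>

context cring
begin

text \<open>For a proper ideal \<open>I\<close> this says that \<open>Spec (R/I)\<close> is connected.\<close>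

definition trivial_idempotents_mod :: "'a set \<Rightarrow> bool"
  where "trivial_idempotents_mod I \<longleftrightarrow>
    (\<forall>f \<in> carrier R. f \<otimes> (\<one> \<ominus> f) \<in> I \<longrightarrow> f \<in> I \<or> \<one> \<ominus> f \<in> I)"

text \<open>With this, \<open>R/P\<close> becomes an indecomposable test module, from which the
  unique minimal prime below \<open>P\<close> is read off.\<close>

lemma trivial_idempotents_mod_prime:
  assumes "primeideal P R"
  shows "trivial_idempotents_mod P"
  using primeideal.I_prime[OF assms] unfolding trivial_idempotents_mod_def by auto

text \<open>This is the ideal generated by the idempotents of \<open>P\<close>, written through the complementary
  idempotents \<open>d = \<one> \<ominus> e\<close>: these are closed under products.\<close>

definition idempotent_core :: "'a set \<Rightarrow> 'a set"
  where "idempotent_core P =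
    {r \<in> carrier R. \<exists>d \<in> carrier R. d \<otimes> d = d \<and> d \<notin> P \<and> r \<otimes> d = \<zero>}"

lemma idempotent_coreI:
  assumes "r \<in> carrier R" "d \<in> carrier R" "d \<otimes> d = d" "d \<notin> P" "r \<otimes> d = \<zero>"
  shows "r \<in> idempotent_core P"
  using assms unfolding idempotent_core_def by blast

lemma idempotent_coreE:
  assumes "r \<in> idempotent_core P"
  obtains d where "r \<in> carrier R" "d \<in> carrier R" "d \<otimes> d = d" "d \<notin> P" "r \<otimes> d = \<zero>"
  using assms unfolding idempotent_core_def by blast

lemma mult_idempotent:
  assumes "d \<in> carrier R" "e \<in> carrier R" "d \<otimes> d = d" "e \<otimes> e = e"
  shows "(d \<otimes> e) \<otimes> (d \<otimes> e) = d \<otimes> e"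
proof -
  have "(d \<otimes> e) \<otimes> (d \<otimes> e) = (d \<otimes> d) \<otimes> (e \<otimes> e)"
    using assms(1,2) by algebra
  then show ?thesis using assms by simp
qed

lemma one_minus_idempotent:
  assumes "d \<in> carrier R" "d \<otimes> d = d"
  shows "(\<one> \<ominus> d) \<otimes> (\<one> \<ominus> d) = \<one> \<ominus> d" "d \<otimes> (\<one> \<ominus> d) = \<zero>"
proof -
  have "(\<one> \<ominus> d) \<otimes> (\<one> \<ominus> d) = \<one> \<ominus> d \<ominus> d \<oplus> d \<otimes> d" "d \<otimes> (\<one> \<ominus> d) = d \<ominus> d \<otimes> d"
    using assms(1) by algebra+
  moreover have "\<one> \<ominus> d \<ominus> d \<oplus> d = \<one> \<ominus> d" using assms(1) by algebra
  ultimately show "(\<one> \<ominus> d) \<otimes> (\<one> \<ominus> d) = \<one> \<ominus> d" "d \<otimes> (\<one> \<ominus> d) = \<zero>"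
    using assms by (simp_all add: a_minus_def r_neg)
qed

text \<open>For a sum, the annihilating idempotents \<open>d\<close> and \<open>e\<close> of the
  summands are replaced by \<open>d \<otimes> e\<close>, which stays outside \<open>P\<close>
  because \<open>P\<close> is prime.\<close>

lemma idempotent_core_ideal:
  assumes "primeideal P R"
  shows "ideal (idempotent_core P) R"
proof (rule idealI[OF ring_axioms])
  interpret P: primeideal P R by fact
  have one: "\<one> \<notin> P" by (rule P.one_notin)
  show "subgroup (idempotent_core P) (add_monoid R)"
  proof (rule group.subgroupI[OF a_group])
    show "idempotent_core P \<subseteq> carrier (add_monoid R)" unfolding idempotent_core_def by auto
    have "\<zero> \<in> idempotent_core P" using one by (intro idempotent_coreI[of _ \<one>]) auto
    then show "idempotent_core P \<noteq> {}" by blast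
    show "inv\<^bsub>add_monoid R\<^esub> a \<in> idempotent_core P" if "a \<in> idempotent_core P" for a
    proof -
      from that obtain d where
        d: "a \<in> carrier R" "d \<in> carrier R" "d \<otimes> d = d" "d \<notin> P" "a \<otimes> d = \<zero>"
        by (rule idempotent_coreE)
      then have "\<ominus> a \<in> idempotent_core P"
        by (intro idempotent_coreI[of _ d]) (auto simp: l_minus)
      then show ?thesis by (simp add: a_inv_def)
    qed
    show "a \<otimes>\<^bsub>add_monoid R\<^esub> b \<in> idempotent_core P"
      if ab: "a \<in> idempotent_core P" "b \<in> idempotent_core P" for a b
    proof -
      from ab(1) obtain d where
        d: "a \<in> carrier R" "d \<in> carrier R" "d \<otimes> d = d" "d \<notin> P" "a \<otimes> d = \<zero>"
        by (rule idempotent_coreE)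
      from ab(2) obtain e where
        e: "b \<in> carrier R" "e \<in> carrier R" "e \<otimes> e = e" "e \<notin> P" "b \<otimes> e = \<zero>"
        by (rule idempotent_coreE)
      have "(a \<oplus> b) \<otimes> (d \<otimes> e) = (a \<otimes> d) \<otimes> e \<oplus> (b \<otimes> e) \<otimes> d"
        using d(1,2) e(1,2) by algebra
      then have "a \<oplus> b \<in> idempotent_core P"
        using d e P.I_prime[of d e] mult_idempotent[of d e]
        by (intro idempotent_coreI[of _ "d \<otimes> e"]) auto
      then show ?thesis by simp
    qed
  qed
next
  fix a x assume a: "a \<in> idempotent_core P" and x: "x \<in> carrier R"
  from a obtain d where
    d: "a \<in> carrier R" "d \<in> carrier R" "d \<otimes> d = d" "d \<notin> P" "a \<otimes> d = \<zero>"
    by (rule idempotent_coreE)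
  show "x \<otimes> a \<in> idempotent_core P"
    using d x by (intro idempotent_coreI[of _ d]) (auto simp: m_assoc)
  then show "a \<otimes> x \<in> idempotent_core P"
    using d x by (simp add: m_comm)
qed

lemma idempotent_core_subset:
  assumes "primeideal P R"
  shows "idempotent_core P \<subseteq> P"
proof
  interpret P: primeideal P R by fact
  fix r assume "r \<in> idempotent_core P"
  then obtain d where "r \<in> carrier R" "d \<in> carrier R" "d \<notin> P" "r \<otimes> d = \<zero>"
    by (rule idempotent_coreE)
  then show "r \<in> P"
    using P.I_prime[of r d] P.zero_closed by simp
qed

text \<open>If \<open>f\<close> is idempotent modulo the core, then some idempotent \<open>d\<close> outside \<open>P\<close> makes
  \<open>f \<otimes> d\<close> idempotent in \<open>R\<close>.\<close>

lemma trivial_idempotents_mod_idempotent_core: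
  assumes "primeideal P R"
  shows "trivial_idempotents_mod (idempotent_core P)"
  unfolding trivial_idempotents_mod_def
proof (intro ballI impI)
  interpret P: primeideal P R by fact
  fix f assume f: "f \<in> carrier R" and ff: "f \<otimes> (\<one> \<ominus> f) \<in> idempotent_core P"
  from ff obtain d where d: "d \<in> carrier R" "d \<otimes> d = d" "d \<notin> P" "f \<otimes> (\<one> \<ominus> f) \<otimes> d = \<zero>"
    by (rule idempotent_coreE)
  define g where "g = f \<otimes> d"
  have g: "g \<in> carrier R" using f d by (simp add: g_def)
  have "g \<otimes> g = f \<otimes> f \<otimes> (d \<otimes> d)" using f d(1) unfolding g_def by algebra
  also have "\<dots> = g \<ominus> f \<otimes> (\<one> \<ominus> f) \<otimes> d" using f d(1) unfolding d(2) g_def by algebra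
  also have "\<dots> = g" using d(4) g by (simp add: a_minus_def)
  finally have gg: "g \<otimes> g = g" .
  show "f \<in> idempotent_core P \<or> \<one> \<ominus> f \<in> idempotent_core P"
  \<comment> \<open>Whichever of \<open>g\<close> and \<open>\<one> \<ominus> g\<close> avoids
    \<open>P\<close> yields the witness: \<open>d \<otimes> (\<one> \<ominus> g)\<close> annihilates
    \<open>f\<close>, while \<open>g\<close> annihilates \<open>\<one> \<ominus> f\<close>.\<close>
  proof (cases "g \<in> P")
    case True
    have "f \<otimes> (d \<otimes> (\<one> \<ominus> g)) = g \<otimes> (\<one> \<ominus> g)"
      using f d(1) g unfolding g_def by (simp add: m_assoc)
    then have "f \<in> idempotent_core P"
      using f d g gg P.one_minus_notin[OF True] P.I_prime[of d "\<one> \<ominus> g"]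
        one_minus_idempotent[OF g gg] mult_idempotent[of d "\<one> \<ominus> g"]
      by (intro idempotent_coreI[of _ "d \<otimes> (\<one> \<ominus> g)"]) auto
    then show ?thesis ..
  next
    case False
    have "(\<one> \<ominus> f) \<otimes> g = f \<otimes> (\<one> \<ominus> f) \<otimes> d" using f d(1) unfolding g_def by algebra
    then have "\<one> \<ominus> f \<in> idempotent_core P"
      using f g gg False d(4) by (intro idempotent_coreI[of _ g]) auto
    then show ?thesis ..
  qed
qed

text \<open>If \<open>r\<close> is in the core but not in \<open>Q\<close>, then the idempotent
  \<open>d\<close> outside \<open>P\<close> with \<open>r \<otimes> d = \<zero>\<close> is forced
  into the prime \<open>Q\<close>.\<close>

lemma obtain_separating_idempotent:
  assumes "Q \<in> Spec R" "Q \<notin> Vset R (idempotent_core P)"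
  obtains d where "d \<in> carrier R" "d \<otimes> d = d" "d \<notin> P" "d \<in> Q"
proof -
  interpret Q: primeideal Q R using assms(1) by (simp add: Spec_def)
  obtain r where r: "r \<in> idempotent_core P" "r \<notin> Q" using assms by (auto simp: Vset_def)
  from r(1) obtain d where d: "r \<in> carrier R" "d \<in> carrier R" "d \<otimes> d = d" "d \<notin> P" "r \<otimes> d = \<zero>"
    by (rule idempotent_coreE)
  have "d \<in> Q" using Q.I_prime[of r d] d r(2) by auto
  then show thesis using that d by blast
qed

text \<open>A separation of \<open>V(I)\<close> would give proper ideals \<open>J\<close> and
  \<open>K\<close> above \<open>I\<close> with elements \<open>j\<close>, \<open>k\<close> such that
  \<open>j \<oplus> k = \<one>\<close> and \<open>j \<otimes> k\<close> is nilpotent modulo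
  \<open>I\<close>. Suitable multiples of powers of \<open>j\<close> and \<open>k\<close> are then
  complementary nontrivial idempotents modulo \<open>I\<close>.\<close>

lemma connectedin_Vset:
  assumes I: "ideal I R" and triv: "trivial_idempotents_mod I"
  shows "connectedin (zariski R) (Vset R I)"
proof -
  interpret I: ideal I R by fact
  \<comment> \<open>\<open>A\<close> and \<open>B\<close> generate the closed complements of the two
    open sets; \<open>P\<close> and \<open>Q\<close> witness that both closed pieces of
    \<open>V(I)\<close> are nonempty.\<close>
  have key: False
    if A: "A \<subseteq> carrier R" "B \<subseteq> carrier R"
      and cov: "\<And>P. P \<in> Vset R I \<Longrightarrow> \<not> (A \<subseteq> P \<and> B \<subseteq> P)"
      and dis: "\<And>P. P \<in> Vset R I \<Longrightarrow> A \<subseteq> P \<or> B \<subseteq> P"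
      and P: "P \<in> Vset R I" "A \<subseteq> P"
      and Q: "Q \<in> Vset R I" "B \<subseteq> Q"
    for A B P Q
  proof -
    define J where "J = Idl (I \<union> A)"
    define K where "K = Idl (I \<union> B)"
    have sub: "I \<union> A \<subseteq> carrier R" "I \<union> B \<subseteq> carrier R" using A I.a_subset by auto
    interpret J: ideal J R using genideal_ideal[OF sub(1)] unfolding J_def .
    interpret K: ideal K R using genideal_ideal[OF sub(2)] unfolding K_def .
    have JI: "I \<subseteq> J" "A \<subseteq> J" and KI: "I \<subseteq> K" "B \<subseteq> K"
      using genideal_self[OF sub(1)] genideal_self[OF sub(2)] unfolding J_def K_def by auto
    have prP: "primeideal P R" "I \<subseteq> P" and prQ: "primeideal Q R" "I \<subseteq> Q"
      using P Q by (auto simp: Vset_def Spec_def)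
    have JP: "J \<subseteq> P" unfolding J_def
      using prP P(2) by (intro genideal_minimal) (auto simp: primeideal_def)
    have KQ: "K \<subseteq> Q" unfolding K_def
      using prQ Q(2) by (intro genideal_minimal) (auto simp: primeideal_def)
    have one: "\<one> \<notin> J" "\<one> \<notin> K"
      using JP KQ primeideal.one_notin prP(1) prQ(1) by blast+
    \<comment> \<open>A prime containing \<open>J + K\<close> would lie in both closed
      pieces.\<close>
    have comax: "\<one> \<in> J <+>\<^bsub>R\<^esub> K"
    proof (rule ccontr)
      assume "\<one> \<notin> J <+>\<^bsub>R\<^esub> K"
      then obtain L where L: "primeideal L R" "J <+>\<^bsub>R\<^esub> K \<subseteq> L"
        using exists_prime_containing[OF add_ideals[OF J.is_ideal K.is_ideal]] by blast
      then have "L \<in> Vset R I" "A \<subseteq> L" "B \<subseteq> L"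
        using JI KI ideal_subset_add[OF J.is_ideal K.is_ideal] by (auto simp: Vset_def Spec_def)
      then show False using cov by blast
    qed
    then obtain j k where jk: "j \<in> J" "k \<in> K" "j \<oplus> k = \<one>"
      unfolding set_add_def' by auto
    have c: "j \<in> carrier R" "k \<in> carrier R" using jk J.a_subset K.a_subset by auto
    \<comment> \<open>Every prime over \<open>I\<close> contains \<open>A\<close> or
      \<open>B\<close>, hence \<open>J\<close> or \<open>K\<close>, hence
      \<open>j \<otimes> k\<close>. So some power of \<open>j \<otimes> k\<close> falls into
      \<open>I\<close>.\<close>
    obtain n :: nat where n: "(j \<otimes> k) [^] n \<in> I"
    proof (rule ccontr)
      assume "\<not> thesis"
      then have "(j \<otimes> k) [^] n \<notin> I" for n :: nat using that by blast
      then obtain L where L: "primeideal L R" "I \<subseteq> L" "j \<otimes> k \<notin> L"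
        using exists_prime_avoiding_powers[OF I, of "j \<otimes> k"] c by blast
      interpret L: primeideal L R by fact
      have "A \<subseteq> L \<or> B \<subseteq> L" using dis L by (auto simp: Vset_def Spec_def)
      then have "J \<subseteq> L \<or> K \<subseteq> L"
        unfolding J_def K_def
        using L(2) genideal_minimal[OF L.is_ideal, of "I \<union> A"]
          genideal_minimal[OF L.is_ideal, of "I \<union> B"]
        by blast
      then show False
        using jk c L(3) L.I_l_closed[of k j] L.I_r_closed[of j k] by auto
    qed
    have pc: "j [^] n \<in> carrier R" "k [^] n \<in> carrier R" using c by auto
    \<comment> \<open>A prime containing both powers would contain \<open>j\<close> and
      \<open>k\<close>, hence their sum \<one>.\<close>
    have "\<one> \<in> PIdl (j [^] n) <+>\<^bsub>R\<^esub> PIdl (k [^] n)"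
    proof (rule ccontr)
      assume "\<not> ?thesis"
      then obtain L where L: "primeideal L R" "PIdl (j [^] n) <+>\<^bsub>R\<^esub> PIdl (k [^] n) \<subseteq> L"
        using exists_prime_containing[OF add_ideals[OF cgenideal_ideal cgenideal_ideal]] pc by metis
      interpret L: primeideal L R by fact
      note sub = ideal_subset_add[OF cgenideal_ideal[OF pc(1)] cgenideal_ideal[OF pc(2)]]
      have "j [^] n \<in> L"
        by (rule subsetD[OF L(2) subsetD[OF sub(1) cgenideal_self[OF pc(1)]]])
      moreover have "k [^] n \<in> L"
        by (rule subsetD[OF L(2) subsetD[OF sub(2) cgenideal_self[OF pc(2)]]])
      ultimately have "j \<in> L" "k \<in> L" by (blast intro: L.pow_mem_imp_mem c)+
      then show False using jk(3) L.one_notin L.a_closed[of j k] by simp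
    qed
    then obtain x y where xy: "x \<in> carrier R" "y \<in> carrier R"
        "\<one> = x \<otimes> j [^] n \<oplus> y \<otimes> k [^] n"
      unfolding set_add_def' cgenideal_def by auto
    \<comment> \<open>For \<open>n = 0\<close> the choice of \<open>n\<close> would put \<one> into
      \<open>I\<close> and so into \<open>J\<close>. A positive exponent keeps the powers of
      \<open>j\<close> and \<open>k\<close> inside \<open>J\<close> and \<open>K\<close>.\<close>
    have n0: "n \<noteq> 0"
      using n one(1) JI(1) by (cases n) auto
    have pow: "j [^] n \<in> J" "k [^] n \<in> K"
      using n0 c jk J.I_l_closed K.I_l_closed by (cases n; auto)+
    define f where "f = x \<otimes> j [^] n"
    have f: "f \<in> carrier R" "f \<in> J" using xy pc pow J.I_l_closed by (auto simp: f_def)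
    have f': "\<one> \<ominus> f = y \<otimes> k [^] n"
    proof -
      have "x \<otimes> j [^] n \<oplus> y \<otimes> k [^] n \<ominus> f = y \<otimes> k [^] n"
        unfolding f_def using xy(1,2) pc by algebra
      then show ?thesis using xy(3) by simp
    qed
    have fK: "\<one> \<ominus> f \<in> K" using f' xy pow K.I_l_closed by auto
    have "f \<otimes> (\<one> \<ominus> f) = (x \<otimes> y) \<otimes> (j [^] n \<otimes> k [^] n)"
      unfolding f' using xy(1,2) pc unfolding f_def by algebra
    also have "\<dots> = (x \<otimes> y) \<otimes> (j \<otimes> k) [^] n"
      using c by (simp add: nat_pow_distrib)
    also have "\<dots> \<in> I" using n xy I.I_l_closed by auto
    finally have "f \<in> I \<or> \<one> \<ominus> f \<in> I" using triv f unfolding trivial_idempotents_mod_def by auto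
    \<comment> \<open>Either alternative puts \<one> into a proper ideal: into \<open>K\<close> if
      \<open>f\<close> is in \<open>I\<close>, into \<open>J\<close> if
      \<open>\<one> \<ominus> f\<close> is.\<close>
    moreover have "(\<one> \<ominus> f) \<oplus> f = \<one>" using f(1) by algebra
    ultimately show False
      using f(2) fK JI(1) KI(1) one J.a_closed[of "\<one> \<ominus> f" f] K.a_closed[of "\<one> \<ominus> f" f] by auto
  qed
  have "Vset R I \<subseteq> Spec R" by (auto simp: Vset_def)
  moreover have False
    if U: "openin (zariski R) U" "openin (zariski R) W"
      and "Vset R I \<subseteq> U \<union> W" "U \<inter> W \<inter> Vset R I = {}"
      and ne: "U \<inter> Vset R I \<noteq> {}" "W \<inter> Vset R I \<noteq> {}"
    for U W
  proof -
    obtain A B where A: "A \<subseteq> carrier R" "U = Spec R - Vset R A"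
      and B: "B \<subseteq> carrier R" "W = Spec R - Vset R B"
      using U unfolding openin_zariski[OF is_cring] by blast
    have mem: "P \<in> U \<longleftrightarrow> \<not> A \<subseteq> P" "P \<in> W \<longleftrightarrow> \<not> B \<subseteq> P" if "P \<in> Vset R I" for P
      using that A B by (auto simp: Vset_def)
    \<comment> \<open>The roles cross: a point of \<open>V(I)\<close> in \<open>W\<close> is outside
      \<open>U\<close> and therefore contains \<open>A\<close>, and a point in \<open>U\<close>
      contains \<open>B\<close>.\<close>
    obtain P Q where P: "P \<in> Vset R I" "P \<in> W" and Q: "Q \<in> Vset R I" "Q \<in> U" using ne by blast
    show False
    proof (rule key[OF A(1) B(1) _ _ P(1) _ Q(1)])
      show "\<not> (A \<subseteq> P \<and> B \<subseteq> P)" "A \<subseteq> P \<or> B \<subseteq> P" if "P \<in> Vset R I" for P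
        using mem[OF that] that U(1) \<open>Vset R I \<subseteq> U \<union> W\<close> \<open>U \<inter> W \<inter> Vset R I = {}\<close> by blast+
      show "A \<subseteq> P" "B \<subseteq> Q"
        using P Q mem \<open>U \<inter> W \<inter> Vset R I = {}\<close> by blast+
    qed
  qed
  ultimately show ?thesis
    unfolding connectedin topspace_zariski[OF is_cring] by blast
qed

end

section \<open>Supports\<close>

text \<open>If \<open>m\<close> is killed by an element of \<open>T\<close>, both classes consist of
  the pairs \<open>(n, t)\<close> whose \<open>n\<close> is killed by an element of
  \<open>T\<close>. Conversely, the zero fraction contains \<open>(\<zero>, \<one>)\<close>, and
  membership of this pair in the class of \<open>(m, s)\<close> gives \<open>u\<close>.\<close>

lemma (in module) fraction_eq_zero_iff:
  assumes T: "T \<subseteq> carrier R" "\<one> \<in> T" "\<And>s t. s \<in> T \<Longrightarrow> t \<in> T \<Longrightarrow> s \<otimes> t \<in> T"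
    and m: "m \<in> carrier M" and s: "s \<in> T"
  shows "fraction T M m s = fraction T M \<zero>\<^bsub>M\<^esub> \<one> \<longleftrightarrow> (\<exists>u \<in> T. u \<odot>\<^bsub>M\<^esub> m = \<zero>\<^bsub>M\<^esub>)"
proof -
  have TR: "t \<in> carrier R" if "t \<in> T" for t using that T(1) by blast
  have zero: "(n, t) \<in> fraction T M \<zero>\<^bsub>M\<^esub> \<one> \<longleftrightarrow>
      n \<in> carrier M \<and> t \<in> T \<and> (\<exists>w \<in> T. w \<odot>\<^bsub>M\<^esub> n = \<zero>\<^bsub>M\<^esub>)" for n t
    using T(2) TR unfolding fraction_def fraction_rel_def by (auto simp: eq_commute[of "\<zero>\<^bsub>M\<^esub>"])
  have ms: "(n, t) \<in> fraction T M m s \<longleftrightarrow> n \<in> carrier M \<and> t \<in> T \<and>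
      (\<exists>v \<in> T. v \<odot>\<^bsub>M\<^esub> (t \<odot>\<^bsub>M\<^esub> m) = v \<odot>\<^bsub>M\<^esub> (s \<odot>\<^bsub>M\<^esub> n))" for n t
    using m s unfolding fraction_def fraction_rel_def by auto
  show ?thesis
  proof
    assume eq: "fraction T M m s = fraction T M \<zero>\<^bsub>M\<^esub> \<one>"
    have "(\<zero>\<^bsub>M\<^esub>, \<one>) \<in> fraction T M \<zero>\<^bsub>M\<^esub> \<one>" using T(2) TR by (auto simp: zero)
    then obtain v where "v \<in> T" "v \<odot>\<^bsub>M\<^esub> (\<one> \<odot>\<^bsub>M\<^esub> m) = v \<odot>\<^bsub>M\<^esub> (s \<odot>\<^bsub>M\<^esub> \<zero>\<^bsub>M\<^esub>)"
      unfolding eq[symmetric] ms by blast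
    then show "\<exists>u \<in> T. u \<odot>\<^bsub>M\<^esub> m = \<zero>\<^bsub>M\<^esub>" using m s TR by auto
  next
    assume "\<exists>u \<in> T. u \<odot>\<^bsub>M\<^esub> m = \<zero>\<^bsub>M\<^esub>"
    then obtain u where u: "u \<in> T" "u \<odot>\<^bsub>M\<^esub> m = \<zero>\<^bsub>M\<^esub>" by blast
    have "(\<exists>v \<in> T. v \<odot>\<^bsub>M\<^esub> (t \<odot>\<^bsub>M\<^esub> m) = v \<odot>\<^bsub>M\<^esub> (s \<odot>\<^bsub>M\<^esub> n)) \<longleftrightarrow>
        (\<exists>w \<in> T. w \<odot>\<^bsub>M\<^esub> n = \<zero>\<^bsub>M\<^esub>)" if n: "n \<in> carrier M" and t: "t \<in> T" for n t
    proof
      assume "\<exists>v \<in> T. v \<odot>\<^bsub>M\<^esub> (t \<odot>\<^bsub>M\<^esub> m) = v \<odot>\<^bsub>M\<^esub> (s \<odot>\<^bsub>M\<^esub> n)"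
      then obtain v where v: "v \<in> T" "v \<odot>\<^bsub>M\<^esub> (t \<odot>\<^bsub>M\<^esub> m) = v \<odot>\<^bsub>M\<^esub> (s \<odot>\<^bsub>M\<^esub> n)" by blast
      \<comment> \<open>The factor \<open>u\<close> annihilates the side containing
        \<open>m\<close>, so the product of \<open>u\<close>, \<open>v\<close> and \<open>s\<close>
        kills \<open>n\<close>.\<close>
      have "(u \<otimes> v \<otimes> s) \<odot>\<^bsub>M\<^esub> n = u \<odot>\<^bsub>M\<^esub> (v \<odot>\<^bsub>M\<^esub> (s \<odot>\<^bsub>M\<^esub> n))"
        using u v s n TR by (simp add: smult_assoc1)
      also have "\<dots> = (u \<otimes> v \<otimes> t) \<odot>\<^bsub>M\<^esub> m"
        using u v t m TR by (simp add: smult_assoc1 flip: v(2))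
      also have "u \<otimes> v \<otimes> t = v \<otimes> t \<otimes> u" using u v t TR by (simp add: m_ac)
      also have "(v \<otimes> t \<otimes> u) \<odot>\<^bsub>M\<^esub> m = \<zero>\<^bsub>M\<^esub>" using u v t m TR by (simp add: smult_assoc1)
      finally show "\<exists>w \<in> T. w \<odot>\<^bsub>M\<^esub> n = \<zero>\<^bsub>M\<^esub>" using T(3) u v s by blast
    next
      assume "\<exists>w \<in> T. w \<odot>\<^bsub>M\<^esub> n = \<zero>\<^bsub>M\<^esub>"
      then obtain w where w: "w \<in> T" "w \<odot>\<^bsub>M\<^esub> n = \<zero>\<^bsub>M\<^esub>" by blast
      have "(u \<otimes> w) \<odot>\<^bsub>M\<^esub> (t \<odot>\<^bsub>M\<^esub> m) = (w \<otimes> t \<otimes> u) \<odot>\<^bsub>M\<^esub> m"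
        "(u \<otimes> w) \<odot>\<^bsub>M\<^esub> (s \<odot>\<^bsub>M\<^esub> n) = (u \<otimes> s \<otimes> w) \<odot>\<^bsub>M\<^esub> n"
        using u w t s m n TR by (simp_all add: m_ac flip: smult_assoc1)
      then have "(u \<otimes> w) \<odot>\<^bsub>M\<^esub> (t \<odot>\<^bsub>M\<^esub> m) = (u \<otimes> w) \<odot>\<^bsub>M\<^esub> (s \<odot>\<^bsub>M\<^esub> n)"
        using u w t s m n TR by (simp add: smult_assoc1)
      then show "\<exists>v \<in> T. v \<odot>\<^bsub>M\<^esub> (t \<odot>\<^bsub>M\<^esub> m) = v \<odot>\<^bsub>M\<^esub> (s \<odot>\<^bsub>M\<^esub> n)"
        using T(3) u w by blast
    qed
    then have "(n, t) \<in> fraction T M m s \<longleftrightarrow> (n, t) \<in> fraction T M \<zero>\<^bsub>M\<^esub> \<one>" for n t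
      unfolding zero ms by (simp cong: conj_cong)
    then show "fraction T M m s = fraction T M \<zero>\<^bsub>M\<^esub> \<one>"
      by auto
  qed
qed

text \<open>The denominator does not affect whether a fraction vanishes, so \<open>P\<close> is in
  the support exactly when some element of \<open>M\<close> has its annihilator inside
  \<open>P\<close>.\<close>

lemma (in module) Supp_iff:
  "P \<in> Supp R M \<longleftrightarrow>
    P \<in> Spec R \<and> (\<exists>m \<in> carrier M. \<forall>u \<in> carrier R - P. u \<odot>\<^bsub>M\<^esub> m \<noteq> \<zero>\<^bsub>M\<^esub>)"
proof (cases "P \<in> Spec R")
  case True
  then interpret P: primeideal P R by (simp add: Spec_def)
  let ?T = "carrier R - P"
  have T: "?T \<subseteq> carrier R" "\<one> \<in> ?T" "\<And>s t. s \<in> ?T \<Longrightarrow> t \<in> ?T \<Longrightarrow> s \<otimes> t \<in> ?T"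
    using P.one_notin P.I_prime by auto
  let ?F = "\<lambda>(m, s). fraction ?T M m s" and ?z = "fraction ?T M \<zero>\<^bsub>M\<^esub> \<one>"
  have carr: "carrier (localization R ?T M) = ?F ` (carrier M \<times> ?T)"
    unfolding localization_def fraction_def quotient_def by auto
  have zero: "\<zero>\<^bsub>localization R ?T M\<^esub> = ?z"
    unfolding localization_def by simp
  have "?F (\<zero>\<^bsub>M\<^esub>, \<one>) \<in> carrier (localization R ?T M)"
    unfolding carr using T(2) by (intro imageI) simp
  then have "carrier (localization R ?T M) = {\<zero>\<^bsub>localization R ?T M\<^esub>} \<longleftrightarrow>
      (\<forall>X \<in> carrier (localization R ?T M). X = ?z)"
    unfolding zero by auto
  also have "\<dots> \<longleftrightarrow> (\<forall>m \<in> carrier M. \<forall>s \<in> ?T. fraction ?T M m s = ?z)"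
    unfolding carr by simp
  also have "\<dots> \<longleftrightarrow> (\<forall>m \<in> carrier M. \<forall>s \<in> ?T. \<exists>u \<in> ?T. u \<odot>\<^bsub>M\<^esub> m = \<zero>\<^bsub>M\<^esub>)"
    using fraction_eq_zero_iff[OF T] by (intro ball_cong refl) simp
  also have "\<dots> \<longleftrightarrow> (\<forall>m \<in> carrier M. \<exists>u \<in> ?T. u \<odot>\<^bsub>M\<^esub> m = \<zero>\<^bsub>M\<^esub>)"
    using T(2) by blast
  finally show ?thesis using True unfolding Supp_def by blast
qed (simp add: Supp_def)

text \<open>The annihilator of a nonzero element is a proper ideal, and any prime above it belongs
  to the support.\<close>

lemma (in module) Supp_nonempty:
  assumes "carrier M \<noteq> {\<zero>\<^bsub>M\<^esub>}"
  shows "Supp R M \<noteq> {}"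
proof -
  obtain m where m: "m \<in> carrier M" "m \<noteq> \<zero>\<^bsub>M\<^esub>" using assms M.zero_closed by blast
  let ?A = "{r \<in> carrier R. r \<odot>\<^bsub>M\<^esub> m = \<zero>\<^bsub>M\<^esub>}"
  have "ideal ?A R"
  proof (rule idealI[OF ring_axioms])
    show "subgroup ?A (add_monoid R)"
      using m by (intro group.subgroupI[OF R.a_group])
        (auto simp: smult_l_distr smult_l_minus simp flip: a_inv_def)
  next
    fix a x assume a: "a \<in> ?A" and x: "x \<in> carrier R"
    show "x \<otimes> a \<in> ?A" using a m x by (simp add: smult_assoc1)
    then show "a \<otimes> x \<in> ?A" using a x by (simp add: R.m_comm)
  qed
  moreover have "\<one> \<notin> ?A" using m by simp
  ultimately obtain P where P: "primeideal P R" "?A \<subseteq> P" by (rule exists_prime_containing)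
  then have "P \<in> Supp R M" unfolding Supp_iff Spec_def using m by blast
  then show ?thesis by blast
qed

section \<open>Idempotents acting on indecomposable modules\<close>

lemma (in left_module) smult_r_null:
  assumes "a \<in> carrier S"
  shows "a \<odot>\<^bsub>M\<^esub> \<zero>\<^bsub>M\<^esub> = \<zero>\<^bsub>M\<^esub>"
proof -
  have "a \<odot>\<^bsub>M\<^esub> \<zero>\<^bsub>M\<^esub> \<oplus>\<^bsub>M\<^esub> a \<odot>\<^bsub>M\<^esub> \<zero>\<^bsub>M\<^esub> = a \<odot>\<^bsub>M\<^esub> \<zero>\<^bsub>M\<^esub>"
    using smult_r_distr[OF assms, of "\<zero>\<^bsub>M\<^esub>" "\<zero>\<^bsub>M\<^esub>"] by simp
  then show ?thesis using smult_closed[OF assms M.zero_closed] M.add.r_cancel_one' by metis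
qed

lemma restrict_scalars_simps [simp]:
  "carrier (restrict_scalars S M) = carrier M"
  "zero (restrict_scalars S M) = zero M"
  "add (restrict_scalars S M) = add M"
  "smult (restrict_scalars S M) r m = (r \<odot>\<^bsub>S\<^esub> \<one>\<^bsub>S\<^esub>) \<odot>\<^bsub>M\<^esub> m"
  by (simp_all add: restrict_scalars_def)

lemma abelian_group_cong:
  assumes "abelian_group M" "carrier N = carrier M" "zero N = zero M" "add N = add M"
  shows "abelian_group N"
proof -
  interpret M: abelian_group M by fact
  show ?thesis
    by (rule abelian_groupI) (auto simp: assms(2-) M.a_ac intro: M.l_neg bexI[of _ "\<ominus>\<^bsub>M\<^esub> x" for x])
qed

locale algebra_module = A?: assoc_algebra R S + L?: left_module S M
  for R :: "('a, 'r) ring_scheme" and S :: "('a, 's) module" and M :: "('s, 'm) module"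
begin

lemma restrict_scalars_module: "module R (restrict_scalars S M)"
proof (rule moduleI[OF A.R.is_cring])
  show "abelian_group (restrict_scalars S M)"
    by (rule abelian_group_cong[OF L.M.abelian_group_axioms]) simp_all
  have one: "r \<odot>\<^bsub>S\<^esub> \<one>\<^bsub>S\<^esub> \<in> carrier S" if "r \<in> carrier R" for r
    using that by simp
  fix a b x assume a: "a \<in> carrier R" and b: "b \<in> carrier R"
    and x: "x \<in> carrier (restrict_scalars S M)"
  have "(a \<odot>\<^bsub>S\<^esub> \<one>\<^bsub>S\<^esub>) \<otimes>\<^bsub>S\<^esub> (b \<odot>\<^bsub>S\<^esub> \<one>\<^bsub>S\<^esub>) = (a \<otimes>\<^bsub>R\<^esub> b) \<odot>\<^bsub>S\<^esub> \<one>\<^bsub>S\<^esub>"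
    using a b by (simp add: A.smult_mult_left A.smult_assoc1)
  then show "(a \<otimes>\<^bsub>R\<^esub> b) \<odot>\<^bsub>restrict_scalars S M\<^esub> x =
      a \<odot>\<^bsub>restrict_scalars S M\<^esub> (b \<odot>\<^bsub>restrict_scalars S M\<^esub> x)"
    using L.smult_assoc[OF one[OF a] one[OF b], of x] x by simp
qed (simp_all add: L.smult_closed L.smult_l_distr L.smult_r_distr L.smult_one
      A.smult_l_distr A.smult_one)

sublocale Q: module R "restrict_scalars S M"
  by (rule restrict_scalars_module)

text \<open>The two compatibility axioms of \<open>assoc_algebra\<close> together make the image of
  \<open>r\<close> central in \<open>S\<close>, so \<open>r\<close> acts on \<open>M\<close> by an
  \<open>S\<close>-linear map.\<close>

lemma smult_commute:
  assumes "r \<in> carrier R" "a \<in> carrier S" "x \<in> carrier M"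
  shows "a \<odot>\<^bsub>M\<^esub> (r \<odot>\<^bsub>restrict_scalars S M\<^esub> x) = r \<odot>\<^bsub>restrict_scalars S M\<^esub> (a \<odot>\<^bsub>M\<^esub> x)"
proof -
  have "a \<otimes>\<^bsub>S\<^esub> (r \<odot>\<^bsub>S\<^esub> \<one>\<^bsub>S\<^esub>) = (r \<odot>\<^bsub>S\<^esub> \<one>\<^bsub>S\<^esub>) \<otimes>\<^bsub>S\<^esub> a"
    using assms by (simp add: A.smult_mult_left A.smult_mult_right)
  then show ?thesis
    using assms by (simp flip: L.smult_assoc)
qed

text \<open>This is the kernel of multiplication by \<open>r\<close>; \<open>S\<close>-linearity of
  that map makes it stable under \<open>S\<close> and not merely under \<open>R\<close>.\<close>

lemma annihilated_submodule:
  assumes "r \<in> carrier R"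
  shows "submodule {x \<in> carrier M. r \<odot>\<^bsub>restrict_scalars S M\<^esub> x = \<zero>\<^bsub>M\<^esub>} S M"
    (is "submodule ?N S M")
proof (rule submodule.intro)
  show "subgroup ?N (add_monoid M)"
  proof (rule group.subgroupI[OF L.M.a_group])
    show "?N \<noteq> {}" using Q.smult_r_null[OF assms] by auto
    show "inv\<^bsub>add_monoid M\<^esub> x \<in> ?N" if "x \<in> ?N" for x
    proof -
      have x: "x \<in> carrier M" "r \<odot>\<^bsub>restrict_scalars S M\<^esub> x = \<zero>\<^bsub>M\<^esub>" using that by auto
      have y: "\<ominus>\<^bsub>M\<^esub> x \<in> carrier M" using x by simp
      have "r \<odot>\<^bsub>restrict_scalars S M\<^esub> (x \<oplus>\<^bsub>M\<^esub> \<ominus>\<^bsub>M\<^esub> x) =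
          r \<odot>\<^bsub>restrict_scalars S M\<^esub> x \<oplus>\<^bsub>M\<^esub> r \<odot>\<^bsub>restrict_scalars S M\<^esub> (\<ominus>\<^bsub>M\<^esub> x)"
        using Q.smult_r_distr[OF assms, of x "\<ominus>\<^bsub>M\<^esub> x"] x(1) y by simp
      then have "r \<odot>\<^bsub>restrict_scalars S M\<^esub> (\<ominus>\<^bsub>M\<^esub> x) = \<zero>\<^bsub>M\<^esub>"
        using x y assms Q.smult_closed[OF assms, of "\<ominus>\<^bsub>M\<^esub> x"] Q.smult_r_null[OF assms]
        by (simp add: L.M.r_neg)
      then show ?thesis using y by (simp flip: a_inv_def)
    qed
    show "x \<otimes>\<^bsub>add_monoid M\<^esub> y \<in> ?N" if "x \<in> ?N" "y \<in> ?N" for x y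
      using that Q.smult_r_distr[OF assms, of x y] by simp
  qed auto
  show "submodule_axioms ?N S M"
    using smult_commute[OF assms] L.smult_r_null L.smult_closed
    by (intro submodule_axioms.intro) (auto simp del: restrict_scalars_simps(4), metis)
qed

text \<open>\<open>M\<close> is the direct sum of the kernels of \<open>d\<close> and
  \<open>\<one> \<ominus> d\<close>, both \<open>S\<close>-submodules, so one of them
  vanishes.\<close>

lemma indecomposable_idempotent_action:
  assumes ind: "indecomposable S M" and d: "d \<in> carrier R" "d \<otimes>\<^bsub>R\<^esub> d = d"
  shows "(\<forall>x \<in> carrier M. d \<odot>\<^bsub>restrict_scalars S M\<^esub> x = \<zero>\<^bsub>M\<^esub>) \<or>
    (\<forall>x \<in> carrier M. (\<one>\<^bsub>R\<^esub> \<ominus>\<^bsub>R\<^esub> d) \<odot>\<^bsub>restrict_scalars S M\<^esub> x = \<zero>\<^bsub>M\<^esub>)"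
proof -
  let ?e = "\<one>\<^bsub>R\<^esub> \<ominus>\<^bsub>R\<^esub> d" and ?Q = "restrict_scalars S M"
  let ?N = "\<lambda>r. {x \<in> carrier M. r \<odot>\<^bsub>?Q\<^esub> x = \<zero>\<^bsub>M\<^esub>}"
  note [simp del] = restrict_scalars_simps(4)
  have e: "?e \<in> carrier R" using d by simp
  have de: "d \<otimes>\<^bsub>R\<^esub> ?e = \<zero>\<^bsub>R\<^esub>" using A.R.one_minus_idempotent(2)[OF d] .
  then have ed: "?e \<otimes>\<^bsub>R\<^esub> d = \<zero>\<^bsub>R\<^esub>" using A.R.m_comm d(1) e by simp
  have closed: "d \<odot>\<^bsub>?Q\<^esub> x \<in> carrier M" "?e \<odot>\<^bsub>?Q\<^esub> x \<in> carrier M" if "x \<in> carrier M" for x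
    using Q.smult_closed d(1) e that by auto
  have split: "x = ?e \<odot>\<^bsub>?Q\<^esub> x \<oplus>\<^bsub>M\<^esub> d \<odot>\<^bsub>?Q\<^esub> x" if x: "x \<in> carrier M" for x
  proof -
    have "?e \<oplus>\<^bsub>R\<^esub> d = \<one>\<^bsub>R\<^esub>" using d(1) by algebra
    then show ?thesis using Q.smult_l_distr[OF e d(1), of x] Q.smult_one[of x] x by simp
  qed
  \<comment> \<open>Each of the two idempotents maps \<open>M\<close> into the kernel of the other.
    Hence, if the kernel of \<open>d\<close> is zero, it is \<open>\<one> \<ominus> d\<close> that
    acts as zero.\<close>
  have N: "?e \<odot>\<^bsub>?Q\<^esub> x \<in> ?N d" "d \<odot>\<^bsub>?Q\<^esub> x \<in> ?N ?e" if x: "x \<in> carrier M" for x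
    using Q.smult_assoc1[OF d(1) e, of x] Q.smult_assoc1[OF e d(1), of x] closed[OF x]
      Q.smult_l_null[of x] x de ed by simp_all
  have "?N d \<inter> ?N ?e = {\<zero>\<^bsub>M\<^esub>}"
  proof -
    have "x = \<zero>\<^bsub>M\<^esub>" if "x \<in> ?N d \<inter> ?N ?e" for x
      using split[of x] that by simp
    moreover have "\<zero>\<^bsub>M\<^esub> \<in> ?N d \<inter> ?N ?e"
      using Q.smult_r_null[OF d(1)] Q.smult_r_null[OF e] by simp
    ultimately show ?thesis by blast
  qed
  moreover have "?N d <+>\<^bsub>M\<^esub> ?N ?e = carrier M"
  proof
    show "?N d <+>\<^bsub>M\<^esub> ?N ?e \<subseteq> carrier M" by (auto simp: set_add_def')
    show "carrier M \<subseteq> ?N d <+>\<^bsub>M\<^esub> ?N ?e"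
    proof
      fix x assume "x \<in> carrier M"
      then have "x = ?e \<odot>\<^bsub>?Q\<^esub> x \<oplus>\<^bsub>M\<^esub> d \<odot>\<^bsub>?Q\<^esub> x"
        "?e \<odot>\<^bsub>?Q\<^esub> x \<in> ?N d" "d \<odot>\<^bsub>?Q\<^esub> x \<in> ?N ?e"
        using split N by auto
      then show "x \<in> ?N d <+>\<^bsub>M\<^esub> ?N ?e" unfolding set_add_def' by blast
    qed
  qed
  ultimately have "?N d = {\<zero>\<^bsub>M\<^esub>} \<or> ?N ?e = {\<zero>\<^bsub>M\<^esub>}"
    using ind annihilated_submodule[OF d(1)] annihilated_submodule[OF e]
    unfolding indecomposable_def by blast
  then show ?thesis using N by blast
qed

end

section \<open>Cyclic modules\<close>

text \<open>The support condition ranges over plain \<open>module\<close> records, so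
  \<open>R\<close> is repackaged as one to serve as an algebra over itself.\<close>

definition self_algebra :: "('a, 'r) ring_scheme \<Rightarrow> ('a, 'a) module"
  where "self_algebra R =
    \<lparr>carrier = carrier R, mult = mult R, one = one R, zero = zero R, add = add R, smult = mult R\<rparr>"

text \<open>The elements are cosets, which is where the carrier type \<open>'a set\<close> in the
  theorem comes from.\<close>

definition quotient_module :: "('a, 'r) ring_scheme \<Rightarrow> 'a set \<Rightarrow> ('a, 'a set) module"
  where "quotient_module R I =
    \<lparr>carrier = carrier (R Quot I), mult = mult (R Quot I), one = one (R Quot I),
     zero = zero (R Quot I), add = add (R Quot I),
     smult = (\<lambda>r X. (I +>\<^bsub>R\<^esub> r) \<otimes>\<^bsub>R Quot I\<^esub> X)\<rparr>"

lemma self_algebra_simps [simp]: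
  "carrier (self_algebra R) = carrier R"
  "mult (self_algebra R) = mult R"
  "one (self_algebra R) = one R"
  "zero (self_algebra R) = zero R"
  "add (self_algebra R) = add R"
  "smult (self_algebra R) = mult R"
  by (simp_all add: self_algebra_def)

context cring
begin

lemma self_algebra_cring: "cring (self_algebra R)"
proof (rule cringI)
  show "abelian_group (self_algebra R)"
    by (rule abelian_group_cong[OF abelian_group_axioms]) simp_all
  show "comm_monoid (self_algebra R)"
    by (rule comm_monoidI) (simp_all add: m_assoc, rule m_comm)
qed (simp add: l_distr)

lemma self_algebra_assoc_algebra: "assoc_algebra R (self_algebra R)"
proof -
  interpret S: cring "self_algebra R" by (rule self_algebra_cring)
  have "module R (self_algebra R)"
    by (rule moduleI) (auto simp: is_cring S.abelian_group_axioms l_distr r_distr m_assoc)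
  then show ?thesis
    by (intro assoc_algebra.intro assoc_algebra_axioms.intro S.ring_axioms) (auto simp: m_ac)
qed

end

context ideal
begin

lemma quotient_module_carrier: "carrier (quotient_module R I) = (+>) I ` carrier R"
  by (auto simp: quotient_module_def FactRing_def A_RCOSETS_def')

lemma quotient_module_zero: "\<zero>\<^bsub>quotient_module R I\<^esub> = I"
  by (simp add: quotient_module_def FactRing_def)

lemma quotient_module_add:
  assumes "x \<in> carrier R" "y \<in> carrier R"
  shows "(I +> x) \<oplus>\<^bsub>quotient_module R I\<^esub> (I +> y) = I +> (x \<oplus> y)"
  using assms by (simp add: quotient_module_def FactRing_def a_rcos_sum)

lemma quotient_module_smult:
  assumes "x \<in> carrier R" "y \<in> carrier R"
  shows "x \<odot>\<^bsub>quotient_module R I\<^esub> (I +> y) = I +> (x \<otimes> y)"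
  using assms by (simp add: quotient_module_def FactRing_def rcoset_mult_add)

lemma coset_eq_ideal_iff:
  assumes "x \<in> carrier R"
  shows "I +> x = I \<longleftrightarrow> x \<in> I"
  using assms rcos_const_imp_mem a_rcos_zero[OF is_ideal] by blast

lemma quotient_module_left_module: "left_module (self_algebra R) (quotient_module R I)"
  if "cring R"
proof -
  interpret S: cring "self_algebra R" using cring.self_algebra_cring[OF that] .
  interpret Q: ring "R Quot I" by (rule quotient_is_ring)
  have ab: "abelian_group (quotient_module R I)"
    by (rule abelian_group_cong[OF Q.abelian_group_axioms]) (simp_all add: quotient_module_def)
  show ?thesis
    by (intro left_module.intro left_module_axioms.intro ab S.ring_axioms)
      (auto simp: quotient_module_carrier quotient_module_add quotient_module_smult
        l_distr r_distr m_assoc)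
qed

text \<open>In a decomposition, split the coset of \<one> into components represented by
  \<open>f\<close> and \<open>\<one> \<ominus> f\<close>. Their product lies in both summands, so
  \<open>f\<close> is idempotent modulo \<open>I\<close>, hence trivial there. One summand then
  contains the generator and is everything.\<close>

lemma quotient_module_indecomposable:
  assumes "cring R" "\<one> \<notin> I" and triv: "cring.trivial_idempotents_mod R I"
  shows "indecomposable (self_algebra R) (quotient_module R I)"
  unfolding indecomposable_def quotient_module_zero
proof (intro conjI allI impI)
  interpret R: cring R by fact
  interpret M: left_module "self_algebra R" "quotient_module R I"
    by (rule quotient_module_left_module) fact
  let ?M = "quotient_module R I"
  have "I +> \<one> \<in> carrier ?M" by (simp add: quotient_module_carrier)
  then show "carrier ?M \<noteq> {I}"
    using assms(2) coset_eq_ideal_iff[of \<one>] by auto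
  fix N N'
  assume "submodule N (self_algebra R) ?M \<and> submodule N' (self_algebra R) ?M \<and>
    N \<inter> N' = {I} \<and> N <+>\<^bsub>?M\<^esub> N' = carrier ?M"
  then have sub: "submodule N (self_algebra R) ?M" "submodule N' (self_algebra R) ?M"
    and int: "N \<inter> N' = {I}" and sum: "N <+>\<^bsub>?M\<^esub> N' = carrier ?M" by auto
  have carr: "N \<subseteq> carrier ?M" "N' \<subseteq> carrier ?M"
    using sub by (auto simp: submodule_def dest: subgroup.mem_carrier)
  have smult: "I +> (r \<otimes> x) \<in> N" if "I +> x \<in> N" "r \<in> carrier R" "x \<in> carrier R" for r x
    using submodule.smult_closed[OF sub(1), of r "I +> x"] that by (simp add: quotient_module_smult)
  have smult': "I +> (r \<otimes> x) \<in> N'" if "I +> x \<in> N'" "r \<in> carrier R" "x \<in> carrier R" for r x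
    using submodule.smult_closed[OF sub(2), of r "I +> x"] that by (simp add: quotient_module_smult)
  have "I +> \<one> \<in> N <+>\<^bsub>?M\<^esub> N'"
    using \<open>I +> \<one> \<in> carrier ?M\<close> sum by simp
  then obtain X Y where XY: "X \<in> N" "Y \<in> N'" "I +> \<one> = X \<oplus>\<^bsub>?M\<^esub> Y"
    by (auto simp: set_add_def')
  have "X \<in> (+>) I ` carrier R" "Y \<in> (+>) I ` carrier R"
    using XY carr unfolding quotient_module_carrier by auto
  then obtain f g where f: "f \<in> carrier R" "X = I +> f" and g: "g \<in> carrier R" "Y = I +> g"
    by (elim imageE)
  have fg: "I +> \<one> = I +> (f \<oplus> g)" using XY f g quotient_module_add by simp
  \<comment> \<open>The representative \<open>g\<close> of the second component is traded for
    \<open>\<one> \<ominus> f\<close>, which lies in the same coset.\<close>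
  have "I +> (\<one> \<ominus> f) = (I +> \<one>) <+> (I +> \<ominus> f)"
    using f(1) by (simp add: a_rcos_sum a_minus_def)
  also have "\<dots> = I +> (f \<oplus> g \<oplus> \<ominus> f)"
    unfolding fg using f(1) g(1) by (simp add: a_rcos_sum)
  also have "f \<oplus> g \<oplus> \<ominus> f = g" using f(1) g(1) by algebra
  finally have g': "I +> (\<one> \<ominus> f) \<in> N'" using XY g by simp
  have f': "I +> f \<in> N" using XY f by simp
  have coset_zero: "I +> \<zero> = I"
    by (rule a_rcos_zero[OF is_ideal additive_subgroup.zero_closed[OF is_additive_subgroup]])
  have "I +> (f \<otimes> (\<one> \<ominus> f)) \<in> N'" using smult'[OF g'] f(1) by simp
  moreover have "I +> (f \<otimes> (\<one> \<ominus> f)) \<in> N"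
    using smult[OF f', of "\<one> \<ominus> f"] f(1) by (simp add: R.m_comm)
  ultimately have "I +> (f \<otimes> (\<one> \<ominus> f)) = I" using int by blast
  then have "f \<otimes> (\<one> \<ominus> f) \<in> I" using f(1) by (simp add: coset_eq_ideal_iff)
  then consider "f \<in> I" | "\<one> \<ominus> f \<in> I"
    using triv f(1) unfolding R.trivial_idempotents_mod_def by blast
  then show "N = {I} \<or> N' = {I}"
  proof cases
    case 1
    then have "I +> f = I +> \<zero>"
      using coset_zero a_rcos_zero[OF is_ideal 1] by simp
    then have "I +> \<one> = I +> g"
      using XY f g quotient_module_add[of \<zero> g] by simp
    then have "I +> x \<in> N'" if "x \<in> carrier R" for x
      using smult'[of \<one> x] that XY g by simp
    then have "carrier ?M \<subseteq> N'" by (auto simp: quotient_module_carrier)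
    then show ?thesis using int carr by blast
  next
    case 2
    have "f \<oplus> (\<one> \<ominus> f) = \<one>" using f(1) by algebra
    then have "I +> \<one> = (I +> f) <+> (I +> (\<one> \<ominus> f))"
      using f(1) by (simp add: a_rcos_sum)
    also have "\<dots> = (I +> f) <+> (I +> \<zero>)"
      using coset_zero a_rcos_zero[OF is_ideal 2] by simp
    also have "\<dots> = I +> f" using f(1) by (simp add: a_rcos_sum)
    finally have "I +> x \<in> N" if "x \<in> carrier R" for x
      using smult[of \<one> x] that f' by simp
    then have "carrier ?M \<subseteq> N" by (auto simp: quotient_module_carrier)
    then show ?thesis using int carr by blast
  qed
qed

text \<open>If \<open>I\<close> is contained in \<open>P\<close>, the coset of \<one> has
  annihilator \<open>I\<close> inside \<open>P\<close>. Otherwise an element of \<open>I\<close>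
  outside \<open>P\<close> kills every coset.\<close>

lemma Supp_quotient_module:
  assumes "cring R"
  shows "Supp R (restrict_scalars (self_algebra R) (quotient_module R I)) = Vset R I"
proof -
  interpret R: cring R by fact
  interpret Q: algebra_module R "self_algebra R" "quotient_module R I"
    by (intro algebra_module.intro R.self_algebra_assoc_algebra quotient_module_left_module assms)
  show ?thesis
  proof (rule Set.set_eqI)
    fix P
    have "P \<in> Supp R (restrict_scalars (self_algebra R) (quotient_module R I)) \<longleftrightarrow>
      P \<in> Spec R \<and> (\<exists>x \<in> carrier R. \<forall>u \<in> carrier R - P. u \<otimes> x \<notin> I)"
      unfolding Q.Q.Supp_iff
      by (auto simp: quotient_module_carrier quotient_module_zero quotient_module_smult
          coset_eq_ideal_iff)
    also have "\<dots> \<longleftrightarrow> P \<in> Spec R \<and> I \<subseteq> P"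
      using I_r_closed a_subset by (auto intro!: bexI[of _ \<one>])
    finally show "P \<in> Supp R (restrict_scalars (self_algebra R) (quotient_module R I)) \<longleftrightarrow>
        P \<in> Vset R I"
      by (simp add: Vset_def)
  qed
qed

end

section \<open>The space of minimal primes\<close>

text \<open>The product of \<open>d\<close> and \<open>\<one> \<ominus> d\<close> is \<zero> and
  their sum is \<one>, so exactly one of them is in \<open>P\<close>. Idempotents thus cut out
  clopen sets of primes.\<close>

lemma (in cring) mem_prime_iff_complement_notin:
  assumes "d \<in> carrier R" "d \<otimes> d = d" "primeideal P R"
  shows "d \<in> P \<longleftrightarrow> \<one> \<ominus> d \<notin> P"
proof -
  interpret P: primeideal P R by fact
  show ?thesis
    using P.one_minus_notin P.I_prime[of d "\<one> \<ominus> d"] one_minus_idempotent(2)[OF assms(1,2)]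
      assms(1) P.zero_closed by auto
qed

locale unique_minimal_primes = cring R for R (structure) +
  assumes unique: "primes_contain_unique_minimal R"
begin

lemma minimal_below:
  assumes "P \<in> Spec R"
  shows "minimal_below R P \<in> MinSpec R" "minimal_below R P \<subseteq> P"
  using theI'[OF unique[unfolded primes_contain_unique_minimal_def, rule_format, OF assms]]
  unfolding minimal_below_def by auto

lemma minimal_below_eq:
  assumes "P \<in> Spec R" "A \<in> MinSpec R" "A \<subseteq> P"
  shows "minimal_below R P = A"
  using unique minimal_below[OF assms(1)] assms
  unfolding primes_contain_unique_minimal_def by blast

lemma topspace_QMin: "topspace (QMin R) = MinSpec R"
proof
  have "{P \<in> Spec R. minimal_below R P \<in> MinSpec R} = topspace (zariski R)"
    using minimal_below by (auto simp: topspace_zariski[OF is_cring])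
  then have "openin (QMin R) (MinSpec R)"
    unfolding QMin_def openin_quotient_topology
    by (metis topspace_zariski[OF is_cring] openin_topspace subset_refl)
  then show "MinSpec R \<subseteq> topspace (QMin R)" by (rule openin_subset)
  show "topspace (QMin R) \<subseteq> MinSpec R"
    using openin_topspace[of "QMin R"] unfolding QMin_def openin_quotient_topology by blast
qed

lemma continuous_map_minimal_below: "continuous_map (zariski R) (QMin R) (minimal_below R)"
  using minimal_below unfolding continuous_map_def topspace_QMin
  by (auto simp: topspace_zariski[OF is_cring] QMin_def openin_quotient_topology)

text \<open>A prime and the minimal prime below it contain the same idempotents, since a missing
  \<open>d\<close> puts \<open>\<one> \<ominus> d\<close> into both. So the preimage in the spectrum
  is the basic open set of \<open>d\<close>.\<close>

lemma openin_QMin_idempotent: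
  assumes d: "d \<in> carrier R" "d \<otimes> d = d"
  shows "openin (QMin R) {A \<in> MinSpec R. d \<notin> A}"
proof -
  have "d \<in> minimal_below R P \<longleftrightarrow> d \<in> P" if P: "P \<in> Spec R" for P
  proof -
    have "primeideal P R" "primeideal (minimal_below R P) R"
      using P minimal_below(1)[OF P] by (auto simp: Spec_def MinSpec_def)
    then show ?thesis
      using mem_prime_iff_complement_notin[OF d] minimal_below(2)[OF P] by blast
  qed
  then have "{P \<in> Spec R. minimal_below R P \<in> {A \<in> MinSpec R. d \<notin> A}} = Spec R - Vset R {d}"
    using minimal_below(1) by (auto simp: Vset_def)
  moreover have "openin (zariski R) (Spec R - Vset R {d})"
    unfolding openin_zariski[OF is_cring] using d(1) by blast
  ultimately show ?thesis
    unfolding QMin_def openin_quotient_topology topspace_zariski[OF is_cring] by auto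
qed

text \<open>The zero set of the core of \<open>P\<close> is connected, so its image in
  \<open>QMin R\<close> is a single point, the minimal prime below \<open>P\<close>. Hence
  \<open>Q\<close> is outside this zero set.\<close>

lemma separating_idempotent:
  assumes td: "totally_disconnected (QMin R)" and P: "P \<in> Spec R" and Q: "Q \<in> Spec R"
    and ne: "minimal_below R P \<noteq> minimal_below R Q"
  obtains d where "d \<in> carrier R" "d \<otimes> d = d" "d \<notin> P" "d \<in> Q"
proof -
  have prP: "primeideal P R" using P by (simp add: Spec_def)
  let ?V = "Vset R (idempotent_core P)"
  have "connectedin (QMin R) (minimal_below R ` ?V)"
    by (intro connectedin_continuous_map_image[OF continuous_map_minimal_below]
        connectedin_Vset idempotent_core_ideal trivial_idempotents_mod_idempotent_core prP)
  then obtain x where "minimal_below R ` ?V \<subseteq> {x}"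
    using td unfolding totally_disconnected_def by blast
  moreover have "P \<in> ?V" using P idempotent_core_subset[OF prP] by (simp add: Vset_def)
  ultimately have "Q \<notin> ?V" using ne by blast
  then show thesis using obtain_separating_idempotent[OF Q] that by blast
qed

end

section \<open>From total disconnectedness to supports\<close>

text \<open>If \<open>P\<close> and \<open>L\<close> in the support lay over different minimal
  primes, a separating idempotent \<open>d\<close> would act nontrivially because it avoids
  \<open>P\<close>, and so would \<open>\<one> \<ominus> d\<close> because it avoids
  \<open>L\<close>. Uniqueness of \<open>A\<close> holds because \<open>A\<close> must lie below
  \<open>P\<close>.\<close>

lemma support_condition_if_totally_disconnected:
  assumes R: "cring R" and uniq: "primes_contain_unique_minimal R"
    and td: "totally_disconnected (QMin R)"
  shows "indecomposable_support_condition R TYPE('s) TYPE('m)"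
  unfolding indecomposable_support_condition_def
proof (intro allI impI)
  fix S :: "('a, 's) module" and M :: "('s, 'm) module"
  assume "assoc_algebra R S \<and> left_module S M \<and> indecomposable S M"
  then have "assoc_algebra R S" "left_module S M" and ind: "indecomposable S M" by auto
  then interpret algebra_module R S M by (intro algebra_module.intro)
  interpret U: unique_minimal_primes R
    using R uniq by (intro unique_minimal_primes.intro unique_minimal_primes_axioms.intro)
  let ?Q = "restrict_scalars S M"
  note [simp del] = restrict_scalars_simps(4)
  have "Supp R ?Q \<noteq> {}"
    using ind by (intro Q.Supp_nonempty) (simp add: indecomposable_def)
  then obtain P where P: "P \<in> Supp R ?Q" by blast
  have Spec: "L \<in> Spec R" if "L \<in> Supp R ?Q" for L using that by (simp add: Supp_def)
  have const: "minimal_below R L = minimal_below R P" if L: "L \<in> Supp R ?Q" for L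
  proof (rule ccontr)
    assume ne: "\<not> ?thesis"
    obtain d where d: "d \<in> carrier R" "d \<otimes>\<^bsub>R\<^esub> d = d" "d \<notin> P" "d \<in> L"
      by (rule U.separating_idempotent[OF td Spec[OF P] Spec[OF L]]) (use ne in auto)
    have "\<one>\<^bsub>R\<^esub> \<ominus>\<^bsub>R\<^esub> d \<in> carrier R - L"
      using d A.R.mem_prime_iff_complement_notin[OF d(1,2), of L] Spec[OF L] by (auto simp: Spec_def)
    then have "\<not> (\<forall>x \<in> carrier M. (\<one>\<^bsub>R\<^esub> \<ominus>\<^bsub>R\<^esub> d) \<odot>\<^bsub>?Q\<^esub> x = \<zero>\<^bsub>M\<^esub>)"
      using L unfolding Q.Supp_iff by auto
    moreover have "\<not> (\<forall>x \<in> carrier M. d \<odot>\<^bsub>?Q\<^esub> x = \<zero>\<^bsub>M\<^esub>)"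
      using P d unfolding Q.Supp_iff by auto
    ultimately show False using indecomposable_idempotent_action[OF ind d(1,2)] by blast
  qed
  show "\<exists>!A. A \<in> MinSpec R \<and> Supp R ?Q \<subseteq> Vset R A"
  proof (rule ex1I)
    show "minimal_below R P \<in> MinSpec R \<and> Supp R ?Q \<subseteq> Vset R (minimal_below R P)"
      using U.minimal_below(1)[OF Spec[OF P]] U.minimal_below(2) const Spec
      unfolding Vset_def by fastforce
    fix A assume "A \<in> MinSpec R \<and> Supp R ?Q \<subseteq> Vset R A"
    then show "A = minimal_below R P"
      using U.minimal_below_eq[OF Spec[OF P], of A] P by (auto simp: Vset_def)
  qed
qed

section \<open>From supports to total disconnectedness\<close>

text \<open>The support condition is tested on \<open>R/I\<close> over \<open>R\<close> itself,
  whose support is \<open>V(I)\<close>.\<close>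

lemma (in cring) ex1_minimal_Vset_subset:
  assumes cond: "indecomposable_support_condition R TYPE('a) TYPE('a set)"
    and I: "ideal I R" "\<one> \<notin> I" "trivial_idempotents_mod I"
  shows "\<exists>!A. A \<in> MinSpec R \<and> Vset R I \<subseteq> Vset R A"
  using cond self_algebra_assoc_algebra ideal.quotient_module_left_module[OF I(1) is_cring]
    ideal.quotient_module_indecomposable[OF I(1) is_cring I(2,3)]
    ideal.Supp_quotient_module[OF I(1) is_cring]
  unfolding indecomposable_support_condition_def by metis

lemma (in cring) totally_disconnected_if_support_condition:
  assumes cond: "indecomposable_support_condition R TYPE('a) TYPE('a set)"
  shows "primes_contain_unique_minimal R \<and> totally_disconnected (QMin R)"
proof
  show uniq: "primes_contain_unique_minimal R"
    unfolding primes_contain_unique_minimal_def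
  proof
    fix P assume P: "P \<in> Spec R"
    then interpret P: primeideal P R by (simp add: Spec_def)
    have "Vset R P \<subseteq> Vset R A \<longleftrightarrow> A \<subseteq> P" for A
      using P by (auto simp: Vset_def)
    then show "\<exists>!A. A \<in> MinSpec R \<and> A \<subseteq> P"
      using ex1_minimal_Vset_subset[OF cond P.is_ideal P.one_notin
          trivial_idempotents_mod_prime[OF P.primeideal]] by simp
  qed
  interpret U: unique_minimal_primes R
    using uniq by unfold_locales
  show "totally_disconnected (QMin R)"
    unfolding totally_disconnected_def
  proof (intro allI impI)
    fix C assume C: "connectedin (QMin R) C"
    have CM: "C \<subseteq> MinSpec R" using connectedin_subset_topspace[OF C] U.topspace_QMin by simp
    have "A = B" if AB: "A \<in> C" "B \<in> C" for A B
    proof (rule ccontr)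
      assume ne: "A \<noteq> B"
      have min: "A \<in> MinSpec R" "B \<in> MinSpec R" using AB CM by auto
      then have Spec: "A \<in> Spec R" "B \<in> Spec R" and pr: "primeideal A R"
        by (auto simp: MinSpec_def Spec_def)
      interpret A: primeideal A R by fact
      let ?I = "idempotent_core A"
      have "\<one> \<notin> ?I" using idempotent_core_subset[OF pr] A.one_notin by blast
      then obtain A' where A': "A' \<in> MinSpec R" "Vset R ?I \<subseteq> Vset R A'"
        using ex1_minimal_Vset_subset[OF cond idempotent_core_ideal[OF pr] _
            trivial_idempotents_mod_idempotent_core[OF pr]] by blast
      have "A \<in> Vset R ?I" using Spec idempotent_core_subset[OF pr] by (simp add: Vset_def)
      \<comment> \<open>Since \<open>A\<close> itself lies in the zero set of its core, minimality
        identifies \<open>A'\<close> with \<open>A\<close>. Then \<open>B\<close> cannot lie there,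
        as it would contain \<open>A\<close> and equal it by minimality.\<close>
      then have "A' \<subseteq> A" using A' by (auto simp: Vset_def)
      then have "A' = A" using A' min by (auto simp: MinSpec_def)
      then have "B \<notin> Vset R ?I"
        using A' min Spec ne by (auto simp: MinSpec_def Vset_def)
      then obtain d where d: "d \<in> carrier R" "d \<otimes> d = d" "d \<notin> A" "d \<in> B"
        using obtain_separating_idempotent[OF Spec(2)] by blast
      let ?e = "\<one> \<ominus> d"
      have e: "?e \<in> carrier R" "?e \<otimes> ?e = ?e" using d one_minus_idempotent by auto
      have compl: "d \<in> L \<longleftrightarrow> ?e \<notin> L" if "L \<in> MinSpec R" for L
        using mem_prime_iff_complement_notin[OF d(1,2), of L] that by (simp add: MinSpec_def Spec_def)
      \<comment> \<open>Complementary open sets of \<open>QMin R\<close>: \<open>?U\<close> contains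
        \<open>A\<close> and \<open>?W\<close> contains \<open>B\<close>, which disconnects
        \<open>C\<close>.\<close>
      let ?U = "{L \<in> MinSpec R. d \<notin> L}" and ?W = "{L \<in> MinSpec R. ?e \<notin> L}"
      have "openin (QMin R) ?U" "openin (QMin R) ?W"
        using U.openin_QMin_idempotent d e by blast+
      moreover have "C \<subseteq> ?U \<union> ?W" "?U \<inter> ?W \<inter> C = {}"
        using CM compl by blast+
      moreover have "?U \<inter> C \<noteq> {}" "?W \<inter> C \<noteq> {}"
        using AB min d(3,4) compl by blast+
      ultimately show False using connectedinD[OF C] by blast
    qed
    then show "\<exists>x. C \<subseteq> {x}" by blast
  qed
qed

text \<open>The quantifier over all \<open>S\<close> and \<open>M\<close> is split by carrier types.
  The equivalence is stated at \<open>'a\<close> and \<open>'a set\<close>, which suffice for the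
  test modules \<open>R/I\<close>; the second conjunct extends the implication from (2) to (1) to
  arbitrary types.\<close>

theorem proposition4p5:
  fixes R :: "('a, 'r) ring_scheme"
  assumes "cring R"
  shows "(indecomposable_support_condition R TYPE('a) TYPE('a set) \<longleftrightarrow>
            primes_contain_unique_minimal R \<and> totally_disconnected (QMin R)) \<and>
         (primes_contain_unique_minimal R \<and> totally_disconnected (QMin R) \<longrightarrow>
            indecomposable_support_condition R TYPE('s) TYPE('m))"
  using support_condition_if_totally_disconnected[OF assms, where ?'s = 'a and ?'m = "'a set"]
    support_condition_if_totally_disconnected[OF assms, where ?'s = 's and ?'m = 'm]
    cring.totally_disconnected_if_support_condition[OF assms]
  by blast

end
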